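(* Let $\mathbb{P}_\infty$ be the set of all odd integral multiples of $p$, and let $f : \mathbb{C} \setminus \mathbb{P}_\infty \to \mathbb{C}$ be the unique holomorphic function satisfying $f(0) = 0$ and $f'(z) = 1 + f(z)^2$ for all $z \in \mathbb{C} \setminus \mathbb{P}_\infty$. If $a$, $z$ and $a + z$ all lie in $\mathbb{C} \setminus \mathbb{P}_\infty$, then $$f(a + z) = \frac{f(a) + f(z)}{1 - f(a) f(z)}.$$
   Context: Write $B_r(0)$ for the open disc of radius $r$ about $0$ in $\mathbb{C}$. There is a unique holomorphic function $h : B_{1/2}(0) \to \mathbb{C}$ with $h(0)=0$ and $h' = 1 + h^2$; it takes values in the open unit disc. It extends to a holomorphic function $h : B_1(0) \to \mathbb{C}$, given by $z \mapsto \frac{2h(z/2)}{1 - h(z/2)^2}$ in terms of the original $h$ on $B_{1/2}(0)$, which again satisfies $h(0)=0$ and $h'=1+h^2$. It is real-valued on $(-1,1)$. The real number $p$ is the unique $p \in (0,2)$ such that $h(\tfrac12 p) = 1$; equivalently $\tfrac12 p = \int_0^1 \frac{dt}{1+t^2}$. The existence and uniqueness of the holomorphic function $f$ on $\mathbb{C} \setminus \mathbb{P}_\infty$ described in the claim is established in the paper and may be taken as given; $f$ extends $h$. The displayed formula is understood to include that its denominator is nonzero under the stated hypotheses. *)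

theory Defs
  imports "HOL-Complex_Analysis.Complex_Analysis"
begin

text \<open>
  A function with an open domain \<open>S\<close> is represented by a total function on \<^typ>\<open>complex\<close>.
  \<^const>\<open>extensional\<close> fixes its values outside the domain, so that uniqueness on the domain
  becomes genuine uniqueness and the definite description below denotes. Since the domain is
  open, \<^const>\<open>deriv\<close> at a point of the domain does not depend on these outside values.
\<close>

definition h_half :: "complex \<Rightarrow> complex" where
  "h_half = (THE h. h \<in> extensional (ball 0 (1/2)) \<and> h holomorphic_on ball 0 (1/2) \<and>
                    h 0 = 0 \<and> (\<forall>z \<in> ball 0 (1/2). deriv h z = 1 + (h z)\<^sup>2))"

text \<open>The extension of \<^const>\<open>h_half\<close> to the unit disc; meaningful only for \<open>norm z < 1\<close>.\<close>

definition h_disc :: "complex \<Rightarrow> complex" where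
  "h_disc z = 2 * h_half (z / 2) / (1 - (h_half (z / 2))\<^sup>2)"

definition p_const :: real where
  "p_const = (THE p. 0 < p \<and> p < 2 \<and> h_disc (of_real (p / 2)) = 1)"

definition P_infinity :: "complex set" where
  "P_infinity = {of_int k * of_real p_const | k::int. odd k}"

end

theory Submission
  imports Defs
begin

text \<open>
  The function \<open>f\<close> is the tangent. If \<open>f' = 1 + f\<^sup>2\<close> and \<open>f 0 = 0\<close>, then
  \<open>g z = f z * cos z - sin z\<close> solves the linear equation \<open>g' = f * g\<close> with \<open>g 0 = 0\<close>, so \<open>g\<close>
  vanishes near 0, and everywhere by analytic continuation. Applied to \<open>h\<close>, this yields
  \<open>p = pi / 2\<close>, so \<open>P_infinity\<close> is the zero set of the cosine, and the claim is the
  addition theorem of the tangent.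
\<close>

text \<open>The conclusion avoids division, so it needs no prior knowledge that \<open>cos\<close>
  is nonzero on \<open>S\<close>. The domain is kept general to serve both the disc of
  \<open>h_half\<close> and the complement of \<open>P_infinity\<close>.\<close>

lemma tan_ode_unique:
  assumes S: "open S" "connected S" "ball 0 r \<subseteq> S" "r > 0"
    and hol: "f holomorphic_on S" and f0: "f 0 = 0"
    and ode: "\<And>w. w \<in> S \<Longrightarrow> deriv f w = 1 + (f w)\<^sup>2"
    and z: "z \<in> S"
  shows "f z * cos z = sin z"
proof -
  have f': "(f has_field_derivative 1 + (f w)\<^sup>2) (at w)" if "w \<in> S" for w
    using holomorphic_derivI[OF hol S(1) that] ode[OF that] by simp
  define g where "g = (\<lambda>w. f w * cos w - sin w)"
  have g': "(g has_field_derivative f w * g w) (at w)" if "w \<in> S" for w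
    unfolding g_def
    by (rule derivative_eq_intros f' that refl)+ (simp add: algebra_simps power2_eq_square)
  have "f holomorphic_on ball 0 r"
    using hol S(3) by (rule holomorphic_on_subset)
  \<comment> \<open>A primitive \<open>F\<close> of \<open>f\<close> supplies the integrating factor
    \<open>exp (- F)\<close> for \<open>g' = f * g\<close>. It is taken on a disc only, where
    convexity guarantees it; \<open>S\<close> may have holes.\<close>
  then obtain F where F: "\<And>w. w \<in> ball 0 r \<Longrightarrow> (F has_field_derivative f w) (at w within ball 0 r)"
    using holomorphic_convex_primitive'[OF convex_ball open_ball] by blast
  have F': "(F has_field_derivative f w) (at w)" if "w \<in> ball 0 r" for w
    using F[OF that] at_within_open[OF that] by simp
  have g_zero: "g w = 0" if w: "w \<in> ball 0 r" for w
  proof -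
    have "((\<lambda>w. g w * exp (- F w)) has_field_derivative 0) (at u within ball 0 r)"
      if u: "u \<in> ball 0 r" for u
    proof -
      have "u \<in> S" using u S(3) by auto
      note [derivative_intros] = g'[OF this] F'[OF u]
      have "((\<lambda>w. g w * exp (- F w)) has_field_derivative 0) (at u)"
        by (rule derivative_eq_intros refl)+ simp
      then show ?thesis by (rule has_field_derivative_at_within)
    qed
    then obtain c where c: "\<And>u. u \<in> ball 0 r \<Longrightarrow> g u * exp (- F u) = c"
      using has_field_derivative_zero_constant[OF convex_ball, of 0 r "\<lambda>w. g w * exp (- F w)"]
      by blast
    have "c = 0" using c[of 0] S(4) f0 by (simp add: g_def)
    with c[OF w] show ?thesis by simp
  qed
  have "g holomorphic_on S"
    unfolding g_def by (intro holomorphic_intros hol)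
  then have "g z = 0"
    by (rule analytic_continuation[of g S "ball 0 r" 0])
       (use S z g_zero in \<open>auto intro!: islimpt_ball\<close>)
  then show ?thesis by (simp add: g_def)
qed

lemma complex_cos_eq_0_iff:
  "cos (z::complex) = 0 \<longleftrightarrow> (\<exists>k::int. odd k \<and> z = of_int k * of_real (pi / 2))"
proof -
  have "of_real (real_of_int n * pi) + of_real pi / 2
      = (of_int (2 * n + 1) * of_real (pi / 2) :: complex)" for n :: int
    by (simp add: field_simps)
  then show ?thesis
    unfolding cos_eq_0 by (metis oddE even_mult_iff even_numeral odd_add odd_one)
qed

text \<open>An odd integer has absolute value at least 1, so the zeros of the cosine closest to 0
  have norm \<open>pi / 2\<close>.\<close>

lemma cos_nonzero_ball:
  assumes "norm (z::complex) < pi / 2"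
  shows "cos z \<noteq> 0"
proof
  assume "cos z = 0"
  then obtain k :: int where k: "odd k" "z = of_int k * of_real (pi / 2)"
    unfolding complex_cos_eq_0_iff by blast
  have "\<bar>k\<bar> \<ge> 1" using k(1) by (cases "k = 0") auto
  then have "1 * (pi / 2) \<le> real_of_int \<bar>k\<bar> * (pi / 2)"
    by (intro mult_right_mono) (auto simp del: of_int_abs)
  also have "\<dots> = norm z" by (simp add: k(2) norm_mult)
  finally show False using assms by simp
qed

lemma half_less_pi_half: "norm z < 1 / 2 \<Longrightarrow> norm z < pi / 2"
  using pi_gt3 by linarith

text \<open>The description ranges over extensional functions, so the tangent must be cut off
  outside the disc to be its witness.\<close>

lemma h_half_eq_tan: "h_half = restrict tan (ball 0 (1/2))"
  unfolding h_half_def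
proof (rule the_equality)
  have cos: "cos z \<noteq> 0" if "z \<in> ball 0 (1/2)" for z :: complex
    using that by (intro cos_nonzero_ball half_less_pi_half) simp
  have hol: "restrict tan (ball 0 (1/2)) holomorphic_on ball (0::complex) (1/2)"
  proof (rule holomorphic_transform)
    show "tan holomorphic_on ball (0::complex) (1/2)"
      using cos by (rule holomorphic_on_tan)
  qed simp
  have "deriv (restrict tan (ball 0 (1/2))) z = 1 + (tan z)\<^sup>2" if z: "z \<in> ball 0 (1/2)"
    for z :: complex
  proof -
    have "((restrict tan (ball 0 (1/2))) has_field_derivative inverse ((cos z)\<^sup>2)) (at z)"
      by (rule has_field_derivative_transform_within_open[OF DERIV_tan[OF cos[OF z]],
            of "ball 0 (1/2)"])
         (use z in auto)
    then show ?thesis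
      using tan_sec[OF cos[OF z]] by (simp add: DERIV_imp_deriv power_inverse)
  qed
  with hol show "restrict tan (ball 0 (1/2)) \<in> extensional (ball 0 (1/2)) \<and>
      restrict tan (ball 0 (1/2)) holomorphic_on ball (0::complex) (1/2) \<and>
      restrict tan (ball 0 (1/2)) 0 = (0::complex) \<and>
      (\<forall>z\<in>ball (0::complex) (1/2).
        deriv (restrict tan (ball 0 (1/2))) z = 1 + (restrict tan (ball 0 (1/2)) z)\<^sup>2)"
    by simp
  fix h :: "complex \<Rightarrow> complex"
  assume h: "h \<in> extensional (ball 0 (1/2)) \<and> h holomorphic_on ball 0 (1/2) \<and>
    h 0 = 0 \<and> (\<forall>z\<in>ball 0 (1/2). deriv h z = 1 + (h z)\<^sup>2)"
  have "h z = tan z" if z: "z \<in> ball 0 (1/2)" for z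
  proof -
    have "h z * cos z = sin z"
      by (rule tan_ode_unique[of "ball 0 (1/2)" "1/2"]) (use h z in auto)
    then show ?thesis using cos[OF z] by (simp add: tan_def field_simps)
  qed
  then show "h = restrict tan (ball 0 (1/2))"
    using h by (intro extensionalityI[of _ "ball 0 (1/2)"]) auto
qed

text \<open>The formula defining \<open>h_disc\<close> is the duplication formula of the tangent; it
  applies because \<open>z / 2\<close> and \<open>z\<close> both have norm below
  \<open>pi / 2\<close>.\<close>

lemma h_disc_eq_tan:
  assumes "norm z < 1"
  shows "h_disc z = tan z"
proof -
  have "cos (z / 2) \<noteq> 0" "cos z \<noteq> 0"
    using assms pi_gt3 by (auto intro!: cos_nonzero_ball simp: norm_divide)
  then show ?thesis
    using assms tan_double[of "z / 2"] by (simp add: h_disc_def h_half_eq_tan norm_divide)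
qed

lemma p_const_eq: "p_const = pi / 2"
  unfolding p_const_def
proof (rule the_equality)
  have *: "h_disc (of_real (x / 2)) = of_real (tan (x / 2))" if "0 < x" "x < 2" for x
    using that h_disc_eq_tan[of "of_real (x / 2)"] by (simp add: tan_of_real norm_divide)
  show "0 < pi / 2 \<and> pi / 2 < 2 \<and> h_disc (of_real (pi / 2 / 2)) = 1"
    using *[of "pi / 2"] pi_less_4 by (simp add: tan_45)
  fix x assume x: "0 < x \<and> x < 2 \<and> h_disc (of_real (x / 2)) = 1"
  with * have "tan (x / 2) = 1" by (metis of_real_eq_1_iff)
  \<comment> \<open>The bound \<open>x < 2\<close> puts \<open>x / 2\<close> below
    \<open>pi / 2\<close>, on the branch of the tangent that \<open>arctan\<close> inverts.\<close>
  moreover have "arctan (tan (x / 2)) = x / 2"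
    using x pi_gt3 by (intro arctan_tan) linarith+
  ultimately show "x = pi / 2" by (simp add: arctan_one)
qed

lemma P_infinity_eq: "P_infinity = {z. cos z = 0}"
  by (auto simp: P_infinity_def p_const_eq complex_cos_eq_0_iff)

theorem theorem9:
  fixes f :: "complex \<Rightarrow> complex" and a z :: complex
  assumes "f holomorphic_on (UNIV - P_infinity)"
    and "f 0 = 0"
    and "\<And>w. w \<in> UNIV - P_infinity \<Longrightarrow> deriv f w = 1 + (f w)\<^sup>2"
    and "a \<in> UNIV - P_infinity"
    and "z \<in> UNIV - P_infinity"
    and "a + z \<in> UNIV - P_infinity"
  shows "1 - f a * f z \<noteq> 0 \<and> f (a + z) = (f a + f z) / (1 - f a * f z)"
proof -
  let ?S = "UNIV - P_infinity"
  have "closed P_infinity"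
    unfolding P_infinity_eq by (intro closed_Collect_eq continuous_intros)
  then have "open ?S" by (simp add: open_Diff)
  \<comment> \<open>Removing a countable set from the plane leaves it connected, as continuation
    from the disc to all of \<open>?S\<close> requires.\<close>
  have "P_infinity \<subseteq> range (\<lambda>k::int. of_int k * of_real p_const)"
    by (auto simp: P_infinity_def)
  then have "countable P_infinity"
    by (rule countable_subset) simp
  then have "connected ?S"
    using connected_open_diff_countable[of "UNIV :: complex set" P_infinity]
    by (simp add: connected_UNIV)
  have ball: "ball 0 (1/2) \<subseteq> ?S"
    using cos_nonzero_ball[OF half_less_pi_half] by (auto simp: P_infinity_eq)
  have f_eq: "f w = tan w" if "w \<in> ?S" for w
  proof -
    have "f w * cos w = sin w"
      by (rule tan_ode_unique[OF \<open>open ?S\<close> \<open>connected ?S\<close> ball])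
         (use assms that in auto)
    then show ?thesis using that by (simp add: P_infinity_eq tan_def field_simps)
  qed
  have cos: "cos a \<noteq> 0" "cos z \<noteq> 0" "cos (a + z) \<noteq> 0"
    using assms(4-6) by (auto simp: P_infinity_eq)
  \<comment> \<open>The addition theorem of the cosine, divided by \<open>cos a * cos z\<close>. As
    \<open>a + z\<close> is not a zero of the cosine either, the denominator in the claim is
    nonzero.\<close>
  have "1 - tan a * tan z = cos (a + z) / (cos a * cos z)"
    using cos by (intro lemma_tan_add1)
  then show ?thesis
    using cos assms(4-6) by (simp add: f_eq tan_add)
qed

end
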